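(* Let $n\ge 2$ be an integer and let $Q_{4n}=\langle a,b\mid a^{2n}=e,\ a^n=b^2,\ ab=ba^{-1}\rangle$ be the generalized quaternion group of order $4n$. If the cyclic subgroup $\langle a\rangle$ is isomorphic to $\mathbb{Z}_{2^k}\times\mathbb{Z}_p$, where $p\neq 2$ is a prime and $k>1$, then $$\dim(\mathcal{D}(Q_{4n}))=2n-\phi(2n)-\tau(2n)+2.$$ Otherwise, $$\dim(\mathcal{D}(Q_{4n}))=2n-\phi(2n)-\tau(2n)+1.$$
   Context: For a finite group $G$, the power graph $\mathcal{P}(G)$ is the simple graph with vertex set $G$ in which distinct $x,y$ are adjacent iff $x\in\langle y\rangle$ or $y\in\langle x\rangle$. The enhanced power graph $\mathcal{P}_E(G)$ is the simple graph with vertex set $G$ in which distinct $x,y$ are adjacent iff both belong to some common cyclic subgroup of $G$. The difference graph $\mathcal{D}(G)$ is obtained from $\mathcal{P}_E(G)$ by removing all edges of $\mathcal{P}(G)$ and then deleting all isolated vertices. A set $W$ of vertices of a graph is a resolving set if for every pair of distinct vertices $u,v$ there is $z\in W$ with $d(u,z)\ne d(v,z)$, where $d$ is graph distance; the metric dimension $\dim(\Gamma)$ is the minimum size of a resolving set of $\Gamma$. $\phi$ is Euler's totient function and $\tau(m)$ is the number of positive divisors of $m$.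
   Formalization: The formal theorem assumes that n = 2 or that D(Q_{4n}) has at least one vertex; this excludes exactly n = 4, 8, 16, …, where D(Q_{4n}) is empty, its dimension is 0, and the stated formula gives a positive value (1 for n = 4). *)

theory Defs
  imports
    "HOL-Algebra.Elementary_Groups"
    "HOL-Number_Theory.Totient"
    "Graph_Theory.Graph_Theory"
begin

text \<open>
  Simple graphs are represented, as in \<^locale>\<open>pair_graph\<close>, by symmetric loop-free
  digraphs: an undirected edge is a pair of opposite arcs.
\<close>

definition power_graph :: "('a, 'b) monoid_scheme \<Rightarrow> 'a pair_pre_digraph" where
  "power_graph G =
     \<lparr>pverts = carrier G,
      parcs = {(x, y). x \<in> carrier G \<and> y \<in> carrier G \<and> x \<noteq> y \<and>
                       (x \<in> generate G {y} \<or> y \<in> generate G {x})}\<rparr>"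

definition enhanced_power_graph :: "('a, 'b) monoid_scheme \<Rightarrow> 'a pair_pre_digraph" where
  "enhanced_power_graph G =
     \<lparr>pverts = carrier G,
      parcs = {(x, y). x \<noteq> y \<and>
                       (\<exists>C. subgroup C G \<and> cyclic_group (subgroup_generated G C) \<and>
                            x \<in> C \<and> y \<in> C)}\<rparr>"

text \<open>Intended for symmetric graphs only: a vertex without outgoing arcs counts as isolated.\<close>

definition delete_isolated :: "'a pair_pre_digraph \<Rightarrow> 'a pair_pre_digraph" where
  "delete_isolated \<Gamma> =
     \<lparr>pverts = {x \<in> pverts \<Gamma>. \<exists>y. (x, y) \<in> parcs \<Gamma>}, parcs = parcs \<Gamma>\<rparr>"

definition difference_graph :: "('a, 'b) monoid_scheme \<Rightarrow> 'a pair_pre_digraph" where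
  "difference_graph G =
     delete_isolated
       \<lparr>pverts = carrier G,
        parcs = parcs (enhanced_power_graph G) - parcs (power_graph G)\<rparr>"

lemma pair_graph_difference_graph:
  assumes "finite (carrier G)"
  shows "pair_graph (difference_graph G)"
proof -
  have sub: "parcs (difference_graph G) \<subseteq> carrier G \<times> carrier G"
    by (auto simp: difference_graph_def delete_isolated_def enhanced_power_graph_def
        dest: subgroup.mem_carrier)
  have sym: "(y, x) \<in> parcs (difference_graph G)" if "(x, y) \<in> parcs (difference_graph G)" for x y
    using that
    by (auto simp: difference_graph_def delete_isolated_def enhanced_power_graph_def power_graph_def)
  have verts: "x \<in> pverts (difference_graph G)" if "(x, y) \<in> parcs (difference_graph G)" for x y
    using that sub by (auto simp: difference_graph_def delete_isolated_def)
  have "finite (parcs (difference_graph G))"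
    using sub assms by (meson finite_SigmaI finite_subset)
  moreover have "finite (pverts (difference_graph G))"
    using assms by (simp add: difference_graph_def delete_isolated_def)
  moreover have "fst e \<noteq> snd e" if "e \<in> parcs (difference_graph G)" for e
    using that by (auto simp: difference_graph_def delete_isolated_def enhanced_power_graph_def)
  moreover have "symmetric (with_proj (difference_graph G))"
    using sym by (auto simp: symmetric_def arcs_ends_conv with_proj_def intro!: symI)
  ultimately show ?thesis
    using verts sym by unfold_locales fastforce+
qed

text \<open>With all arcs of cost 1, the cheapest walk is a shortest one; the distance between
  vertices in different components is \<open>\<infinity>\<close>.\<close>

definition graph_dist :: "'a pair_pre_digraph \<Rightarrow> 'a \<Rightarrow> 'a \<Rightarrow> ereal" where
  "graph_dist \<Gamma> u v = wf_digraph.\<mu> (with_proj \<Gamma>) (\<lambda>_. 1) u v"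

definition resolving_set :: "'a pair_pre_digraph \<Rightarrow> 'a set \<Rightarrow> bool" where
  "resolving_set \<Gamma> W \<longleftrightarrow> W \<subseteq> pverts \<Gamma> \<and>
     (\<forall>u \<in> pverts \<Gamma>. \<forall>v \<in> pverts \<Gamma>. u \<noteq> v \<longrightarrow>
        (\<exists>z \<in> W. graph_dist \<Gamma> u z \<noteq> graph_dist \<Gamma> v z))"

text \<open>For finite graphs, where the full vertex set is a finite resolving set. The graph
  without vertices gets the value 0; this is the difference graph of \<open>Q\<^sub>4\<^sub>n\<close> when \<open>n\<close> is
  a power of 2, since in a 2-group the power graph and the enhanced power graph agree.\<close>

definition metric_dimension :: "'a pair_pre_digraph \<Rightarrow> nat" where
  "metric_dimension \<Gamma> = (LEAST k. \<exists>W. resolving_set \<Gamma> W \<and> finite W \<and> card W = k)"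

text \<open>
  A group generated by elements \<open>a\<close> and \<open>b\<close> satisfying the relations is a quotient of the
  group presented by \<open>\<langle>a, b | a\<^sup>2\<^sup>n = e, a\<^sup>n = b\<^sup>2, ab = ba\<^sup>-\<^sup>1\<rangle>\<close>. As the latter has order
  \<open>4n\<close>, the condition on the order says that no further relations hold.
\<close>

locale generalized_quaternion = group G for G (structure) +
  fixes n :: nat and a b :: 'a
  assumes a_closed: "a \<in> carrier G"
    and b_closed: "b \<in> carrier G"
    and generated: "carrier G = generate G {a, b}"
    and a_pow_2n: "a [^] (2 * n) = \<one>"
    and a_pow_n: "a [^] n = b [^] (2 :: nat)"
    and a_b: "a \<otimes> b = b \<otimes> inv a"
    and order_eq: "order G = 4 * n"

definition num_divisors :: "nat \<Rightarrow> nat" where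
  "num_divisors m = card {d. d dvd m}"

end

(* Outside the cyclic subgroup generated by a, every element has order 4, so a cyclic subgroup not
   contained in it has order dividing 4 and contributes no edge. Hence the difference graph lives
   on the subgroup generated by a, where two elements are adjacent iff their orders are
   incomparable for divisibility, and its vertices are the elements of order other than 1 and 2n.
   Elements of equal order are twins, so a resolving set misses at most one of each order; this is
   the lower bound. Conversely, let W miss exactly one element of each order. Only the order 2 does
   not occur in W, so W resolves the graph if any two divisors d1, d2 are separated by a divisor
   other than 2 that is comparable to just one of them. The only failure is 2n = 2^k r with r an
   odd prime, k > 1 and {d1, d2} = {r, 2r}, where the involution has to be added. *)

theory Submission
  imports Defs "HOL-Algebra.Multiplicative_Group"
begin

section \<open>Arithmetic of divisors that are incomparable for divisibility\<close>

section \<open>Incomparable divisors\<close>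

abbreviation dvd_incomparable :: "nat \<Rightarrow> nat \<Rightarrow> bool" where
  "dvd_incomparable x y \<equiv> \<not> x dvd y \<and> \<not> y dvd x"

lemma not_dvd_imp_prime_power:
  fixes x y :: nat
  assumes "\<not> y dvd x" "y > 0"
  obtains p k where "prime p" "k > 0" "p ^ k dvd y" "\<not> p ^ k dvd x"
proof (cases "x = 0")
  case True
  with assms show ?thesis by auto
next
  case False
  with assms multiplicity_le_imp_dvd obtain p where p: "prime p" "multiplicity p x < multiplicity p y"
    by (metis not_le gr0_implies_Suc nat.distinct(1))
  have "\<not> p ^ multiplicity p y dvd x"
    using p False not_prime_unit by (subst power_dvd_iff_le_multiplicity) auto
  with p show ?thesis
    by (intro that[of p "multiplicity p y"]) (auto simp: multiplicity_dvd)
qed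

text \<open>Powers of a single prime form a chain, so a prime power dividing only \<open>x\<close>
  and one dividing only \<open>y\<close> have different primes, one of which is not
  \<open>p\<close>. A single arc thus forces \<open>N\<close> not to be a prime power.\<close>

lemma dvd_incomparable_imp_other_prime:
  fixes N x y p :: nat
  assumes "N > 0" "x dvd N" "y dvd N" "dvd_incomparable x y"
  obtains q where "prime q" "q dvd N" "q \<noteq> p"
proof -
  have pos: "x > 0" "y > 0" using assms by (auto intro: dvd_pos_nat)
  obtain r i where r: "prime r" "i > 0" "r ^ i dvd x" "\<not> r ^ i dvd y"
    using not_dvd_imp_prime_power assms(4) pos by metis
  obtain s j where s: "prime s" "j > 0" "s ^ j dvd y" "\<not> s ^ j dvd x"
    using not_dvd_imp_prime_power assms(4) pos by metis
  have "r \<noteq> s"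
  proof
    assume "r = s"
    with r s have "r ^ i dvd r ^ j \<or> r ^ j dvd r ^ i"
      using le_imp_power_dvd nat_le_linear by blast
    with r s \<open>r = s\<close> show False using dvd_trans by blast
  qed
  moreover have "r dvd N" "s dvd N"
    using r s assms(2,3) by (meson dvd_power dvd_trans)+
  ultimately show ?thesis using r(1) s(1) that by metis
qed

text \<open>Some prime power \<open>p ^ k\<close> of \<open>N\<close> does not divide
  \<open>d\<close>. If \<open>d\<close> does not divide it either, it serves as \<open>e\<close>;
  otherwise \<open>d\<close> is a nontrivial power of \<open>p\<close>, and any other prime of
  \<open>N\<close> serves.\<close>

lemma exists_dvd_incomparable:
  fixes N d :: nat
  assumes N: "N > 0" "\<And>p. \<exists>q. prime q \<and> q dvd N \<and> q \<noteq> p"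
    and d: "d dvd N" "d \<noteq> 1" "d \<noteq> N"
  obtains e where "e dvd N" "dvd_incomparable d e"
proof -
  obtain p k where p: "prime p" "k > 0" "p ^ k dvd N" "\<not> p ^ k dvd d"
    using not_dvd_imp_prime_power[of N d] d N(1) by (metis dvd_antisym)
  show ?thesis
  proof (cases "d dvd p ^ k")
    case False
    with p show ?thesis using that by blast
  next
    case True
    obtain q where q: "prime q" "q dvd N" "q \<noteq> p" using N(2) by metis
    have "\<not> q dvd d"
      using q p(1) True by (metis dvd_trans prime_dvd_power primes_dvd_imp_eq)
    moreover have "\<not> d dvd q"
      using q(1) d(2) \<open>\<not> q dvd d\<close> by (metis prime_nat_iff dvd_refl)
    ultimately show ?thesis using q(2) that by blast
  qed
qed

section \<open>Nested pairs of divisors that no divisor other than 2 separates\<close>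

context
  fixes N d1 d2 :: nat
  assumes N: "N > 0" "\<And>p. \<exists>q. prime q \<and> q dvd N \<and> q \<noteq> p"
    and d: "d1 dvd d2" "d2 dvd N" "d1 \<noteq> d2" "d1 \<noteq> 1" "d2 \<noteq> N"
    and eq: "\<And>e. e dvd N \<Longrightarrow> e \<noteq> 2 \<Longrightarrow> dvd_incomparable d1 e \<longleftrightarrow> dvd_incomparable d2 e"
begin

lemma comparable_if_dvd_d2: "d1 dvd e \<or> e dvd d1" if "e dvd d2" "e \<noteq> 2"
  using eq[of e] that d(2) dvd_trans by blast

lemma comparable_if_d1_dvd: "d2 dvd e \<or> e dvd d2" if "d1 dvd e" "e dvd N" "e \<noteq> 2"
  using eq[of e] that by blast

text \<open>Here \<open>d1\<close> is a power \<open>p ^ j\<close>, and \<open>d2\<close> contains a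
  higher power of \<open>p\<close>. Products of powers of \<open>p\<close> with another prime of
  \<open>N\<close> then separate the pair, with 2 as the only obstacle.\<close>

lemma not_prime_power_case:
  assumes p: "prime p" "p ^ m dvd d2" "\<not> p ^ m dvd d1" "d1 dvd p ^ m"
  shows False
proof -
  obtain j where j: "d1 = p ^ j" "j \<le> m"
    using p(1,4) by (auto simp: divides_primepow_nat)
  have j0: "j > 0" using j d(4) by (cases j) auto
  have jm: "j < m" using j p(3) by (cases "j = m") auto
  have psj: "p ^ Suc j dvd d2"
    using jm p(2) by (meson Suc_leI dvd_trans le_imp_power_dvd)
  have pd2: "p dvd d2" using psj by (meson dvd_power dvd_trans zero_less_Suc)
  have step1: "q dvd d2" if q: "prime q" "q dvd N" "q \<noteq> p" for q
  proof (rule ccontr)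
    assume nq: "\<not> q dvd d2"
    have cop: "coprime (p ^ j) q" using q p(1) by (simp add: primes_coprime)
    have "p ^ j dvd N" using j d dvd_trans by blast
    \<comment> \<open>As a multiple of \<open>d1\<close>, this product must be comparable with
      \<open>d2\<close>; but \<open>q\<close> does not divide \<open>d2\<close>, and
      \<open>p ^ Suc j\<close> does not divide the product.\<close>
    then have "p ^ j * q dvd N" using q(2) cop by (rule divides_mult)
    moreover have "p ^ j * q \<noteq> 2"
    proof
      assume "p ^ j * q = 2"
      then have "q dvd 2" "p dvd 2" using j0 by (metis dvd_triv_right, metis dvd_mult2 dvd_power)
      then show False using q p(1) two_is_prime_nat primes_dvd_imp_eq by metis
    qed
    ultimately have "d2 dvd p ^ j * q"
      using comparable_if_d1_dvd[of "p ^ j * q"] j nq by (metis dvd_triv_left dvd_mult_right)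
    then have "p ^ Suc j dvd p ^ j * q" using psj dvd_trans by blast
    then have "p dvd q" using p(1) by (simp add: mult.commute)
    with q p(1) show False using primes_dvd_imp_eq by blast
  qed
  have step2: "j = 1 \<and> q = 2" if q: "prime q" "q dvd N" "q \<noteq> p" for q
  proof (rule ccontr)
    assume neg: "\<not> (j = 1 \<and> q = 2)"
    \<comment> \<open>By \<open>step1\<close> the product \<open>p ^ (j - 1) * q\<close> divides
      \<open>d2\<close>, yet it is incomparable with \<open>p ^ j\<close>; only the excluded value 2
      escapes the contradiction.\<close>
    have cop: "coprime (p ^ (j - 1)) q" using q p(1) by (simp add: primes_coprime)
    have "p ^ (j - 1) dvd d2" using psj by (meson diff_le_self dvd_trans le_SucI le_imp_power_dvd)
    then have dv: "p ^ (j - 1) * q dvd d2" using step1[OF q] cop by (rule divides_mult)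
    have "p ^ (j - 1) * q \<noteq> 2"
    proof
      assume *: "p ^ (j - 1) * q = 2"
      then have "q dvd 2" by (metis dvd_triv_right)
      then have "q = 2" using q two_is_prime_nat primes_dvd_imp_eq by metis
      with * have "p ^ (j - 1) = 1" by simp
      then have "j = 1" using j0 prime_gt_1_nat[OF p(1)] by simp
      with \<open>q = 2\<close> neg show False by simp
    qed
    with comparable_if_dvd_d2[OF dv] j have "p ^ j dvd p ^ (j - 1) * q \<or> p ^ (j - 1) * q dvd p ^ j" by simp
    moreover have "p ^ j = p ^ (j - 1) * p" using j0 by (cases j) auto
    ultimately have "p dvd q \<or> q dvd p" using p(1) by auto
    with q p(1) show False using primes_dvd_imp_eq by blast
  qed
  obtain q where "prime q" "q dvd N" "q \<noteq> p" using N(2) by metis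
  with step2 have j1: "j = 1" and p2: "p \<noteq> 2" and "2 dvd N" by auto
  have d1: "d1 = p" using j j1 by simp
  have two: "2 dvd d2" using step1 p2 \<open>2 dvd N\<close> two_is_prime_nat by metis
  have podd: "\<not> 2 dvd p" using p(1) p2 two_is_prime_nat primes_dvd_imp_eq by metis
  have pp: "p * p dvd d2" using psj j1 by simp
  \<comment> \<open>Since \<open>d2\<close> is not \<open>N\<close>, it lacks a prime power of
    \<open>N\<close>, and \<open>step2\<close> leaves only the primes \<open>p\<close> and 2. For
    \<open>p\<close> the separating divisor is \<open>p ^ k\<close>; for 2 it is
    \<open>4 * p\<close>, or 4 if \<open>4 * p\<close> divides \<open>d2\<close>.\<close>
  obtain t k where t: "prime t" "k > 0" "t ^ k dvd N" "\<not> t ^ k dvd d2"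
    using not_dvd_imp_prime_power[of N d2] N(1) d by (metis dvd_antisym)
  show False
  proof (cases "t = p")
    case True
    have "p dvd p ^ k" using t by simp
    moreover have "p ^ k \<noteq> 2"
      using calculation p(1) p2 two_is_prime_nat primes_dvd_imp_eq by metis
    ultimately have "d2 dvd p ^ k" using comparable_if_d1_dvd[of "p ^ k"] d1 t True by simp
    then have "2 dvd p ^ k" using two dvd_trans by blast
    with podd two_is_prime_nat show False using prime_dvd_power by blast
  next
    case False
    have "t dvd N" using t by (meson dvd_power dvd_trans)
    with step2 False t have t2: "t = 2" by blast
    have "k \<noteq> 1" using t t2 two by auto
    then have "2 ^ 2 dvd N" using t t2
      by (metis One_nat_def Suc_1 Suc_leI dvd_trans le_imp_power_dvd le_neq_implies_less)
    then have four: "4 dvd N" by simp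
    have "coprime 4 p" using podd by (metis coprime_left_2_iff_odd coprime_power_left_iff four_x_squared mult.right_neutral num_double numeral_times_numeral power2_eq_square)
    moreover have "p dvd N" using pd2 d dvd_trans by blast
    ultimately have "4 * p dvd N" using four by (simp add: divides_mult)
    moreover have "4 * p \<noteq> 2" by simp
    ultimately have "d2 dvd 4 * p \<or> 4 * p dvd d2" using comparable_if_d1_dvd d1 by simp
    then show False
    proof
      assume "d2 dvd 4 * p"
      then have "p * p dvd 4 * p" using pp dvd_trans by blast
      then have "p dvd 2 ^ 2" using p(1) by auto
      then show False using p(1) p2 two_is_prime_nat primes_dvd_imp_eq prime_dvd_power by blast
    next
      assume "4 * p dvd d2"
      then have "4 dvd d2" by (metis dvd_mult_left)
      then have "p dvd 2 ^ 2 \<or> 4 dvd p" using comparable_if_dvd_d2[of 4] d1 by simp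
      then show False 
        using p(1) p2 podd two_is_prime_nat primes_dvd_imp_eq prime_dvd_power
        by (metis dvd_trans even_numeral)
    qed
  qed
qed

text \<open>A prime power that divides \<open>d2\<close> but not \<open>d1\<close> can only be 2. So
  \<open>d1\<close> is odd, and for a prime \<open>r\<close> of \<open>d1\<close> the divisor
  \<open>2 * r\<close> of \<open>d2\<close> must be comparable with \<open>d1\<close>, which forces
  \<open>d1 = r\<close> and \<open>d2 = 2 * r\<close>. The bound on \<open>k\<close> comes from
  \<open>d2\<close> not being \<open>N\<close>.\<close>

lemma unseparated_comparable_divisors:
  "\<exists>k r. prime r \<and> r \<noteq> 2 \<and> k > 1 \<and> N = 2 ^ k * r \<and> d1 = r \<and> d2 = 2 * r"
proof -
  have only2: "p ^ m = 2" if "prime p" "p ^ m dvd d2" "\<not> p ^ m dvd d1" for p m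
    using not_prime_power_case[OF that] comparable_if_dvd_d2[OF that(2)] that(3) by blast
  have d2pos: "d2 > 0" using d(2) N(1) dvd_pos_nat by blast
  obtain p m where pm: "prime p" "p ^ m dvd d2" "\<not> p ^ m dvd d1"
    using not_dvd_imp_prime_power[of d2 d1] d2pos d by (metis dvd_antisym)
  have two: "2 dvd d2" "\<not> 2 dvd d1" using only2[OF pm] pm by auto
  obtain r where r: "prime r" "r dvd d1" using d(4) prime_factor_nat by blast
  have r2: "r \<noteq> 2" using r two by blast
  then have rodd: "\<not> 2 dvd r" using r two_is_prime_nat primes_dvd_imp_eq by metis
  then have cop: "coprime 2 r" by simp
  have rd2: "2 * r dvd d2" using r two d cop by (meson divides_mult dvd_trans)
  have "2 * r \<noteq> 2" using r(1) by auto
  with comparable_if_dvd_d2[OF rd2] have "d1 dvd 2 * r \<or> 2 * r dvd d1" by blast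
  then have "d1 dvd r" using two coprime_dvd_mult_right_iff[of d1 2 r]
    by (metis coprime_right_2_iff_odd dvd_mult_left)
  then have d1: "d1 = r" using r dvd_antisym by blast
  have "d2 dvd 2 * r"
  proof (rule ccontr)
    assume "\<not> d2 dvd 2 * r"
    then obtain t k where t: "prime t" "t ^ k dvd d2" "\<not> t ^ k dvd 2 * r"
      using not_dvd_imp_prime_power[of d2 "2 * r"] d2pos by metis
    then have "t ^ k = 2" using only2 d1 by (metis dvd_mult)
    with t show False by simp
  qed
  with rd2 have d2: "d2 = 2 * r" using dvd_antisym by blast
  \<comment> \<open>The odd part \<open>s\<close> of \<open>N\<close> is a multiple of
    \<open>d1\<close>, hence comparable with \<open>2 * r\<close>; being odd, it divides
    \<open>r\<close>.\<close>
  obtain s k where s: "N = 2 ^ k * s" "\<not> 2 dvd s"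
    using multiplicity_decompose'[of N 2] N(1) by (metis not_prime_unit two_is_prime_nat not_gr_zero)
  have "r dvd N" using d1 d dvd_trans by blast
  have "coprime r (2 ^ k)" using cop by (simp add: coprime_commute)
  then have "r dvd s" using \<open>r dvd N\<close> s coprime_dvd_mult_right_iff by blast
  have "s = r"
  proof -
    have "s \<noteq> 2" using s by auto
    then have "d2 dvd s \<or> s dvd 2 * r" using comparable_if_d1_dvd[of s] \<open>r dvd s\<close> d1 d2 s by simp
    then have "s dvd r"
      using d2 s(2) coprime_dvd_mult_right_iff[of s 2 r] by (metis coprime_right_2_iff_odd dvd_mult_left)
    then show ?thesis using \<open>r dvd s\<close> dvd_antisym by blast
  qed
  moreover have "k > 1"
  proof (rule ccontr)
    assume "\<not> k > 1"
    then have "k = 0 \<or> k = 1" by linarith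
    then show False using s \<open>s = r\<close> d2 d two dvd_trans by (metis mult_1 power_0 power_one_right)
  qed
  ultimately show ?thesis using r r2 d1 d2 s by auto
qed

end

section \<open>Distances 0, 1 and 2, and distances from twins\<close>

section \<open>Graph distance\<close>

context pair_wf_digraph
begin

lemma graph_dist_eq_INF:
  "graph_dist G u v = (INF p \<in> {p. awalk u p v}. ereal (real (length p)))"
  unfolding graph_dist_def \<mu>_def awalk_cost_def by (simp add: sum_list_triv)

lemma graph_dist_refl:
  assumes "u \<in> pverts G"
  shows "graph_dist G u u = 0"
proof (rule antisym)
  show "graph_dist G u u \<le> 0"
    unfolding graph_dist_eq_INF using assms by (intro INF_lower2[of "[]"]) (auto simp: awalk_Nil_iff)
qed (auto simp: graph_dist_eq_INF intro: INF_greatest)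

lemma graph_dist_ge_1:
  assumes "u \<noteq> v"
  shows "graph_dist G u v \<ge> 1"
  unfolding graph_dist_eq_INF
proof (rule INF_greatest)
  fix p assume "p \<in> {p. awalk u p v}"
  with assms have "p \<noteq> []" by (auto simp: awalk_Nil_iff)
  then show "1 \<le> ereal (real (length p))" by (cases p) auto
qed

lemma graph_dist_eq_0_iff:
  assumes "u \<in> pverts G"
  shows "graph_dist G u v = 0 \<longleftrightarrow> u = v"
  using assms graph_dist_refl graph_dist_ge_1[of u v] by fastforce

lemma graph_dist_arc:
  assumes "(u, v) \<in> parcs G" "u \<noteq> v"
  shows "graph_dist G u v = 1"
proof (rule antisym)
  show "graph_dist G u v \<le> 1"
    unfolding graph_dist_eq_INF using assms
    by (intro INF_lower2[of "[(u, v)]"]) (auto simp: awalk_simps in_arcsD2)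
qed (rule graph_dist_ge_1[OF assms(2)])

lemma graph_dist_ge_2:
  assumes "(u, v) \<notin> parcs G" "u \<noteq> v"
  shows "graph_dist G u v \<ge> 2"
  unfolding graph_dist_eq_INF
proof (rule INF_greatest)
  fix p assume "p \<in> {p. awalk u p v}"
  with assms have "length p \<ge> 2"
    by (cases p; cases "tl p") (auto simp: awalk_simps)
  then show "2 \<le> ereal (real (length p))" by simp
qed

lemma graph_dist_eq_1_iff:
  assumes "u \<noteq> v"
  shows "graph_dist G u v = 1 \<longleftrightarrow> (u, v) \<in> parcs G"
  using assms graph_dist_arc graph_dist_ge_2[of u v] by fastforce

lemma graph_dist_eq_2:
  assumes "(u, v) \<notin> parcs G" "u \<noteq> v" "(u, w) \<in> parcs G" "(w, v) \<in> parcs G"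
  shows "graph_dist G u v = 2"
proof (rule antisym)
  show "graph_dist G u v \<le> 2"
    unfolding graph_dist_eq_INF using assms
    by (intro INF_lower2[of "[(u, w), (w, v)]"]) (auto simp: awalk_simps in_arcsD2)
qed (rule graph_dist_ge_2[OF assms(1,2)])

text \<open>The first arc of a walk from \<open>u\<close> can be exchanged for an arc from
  \<open>v\<close> to the same vertex, keeping the length; \<open>z \<noteq> u\<close> guarantees
  that there is a first arc.\<close>

lemma graph_dist_twin_le:
  assumes "\<And>w. (u, w) \<in> parcs G \<Longrightarrow> (v, w) \<in> parcs G" "z \<noteq> u"
  shows "graph_dist G v z \<le> graph_dist G u z"
  unfolding graph_dist_eq_INF
proof (rule INF_greatest)
  fix p assume "p \<in> {p. awalk u p z}"
  with assms(2) obtain e q where p: "p = e # q" "e \<in> parcs G" "fst e = u" "awalk (snd e) q z"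
    by (cases p) (auto simp: awalk_simps)
  then have "awalk v ((v, snd e) # q) z"
    using assms(1) by (auto simp: awalk_simps)
  then show "(INF p\<in>{p. awalk v p z}. ereal (real (length p))) \<le> ereal (real (length p))"
    by (intro INF_lower2[of "(v, snd e) # q"]) (auto simp: p)
qed

end

section \<open>Metric dimension of a graph whose arcs are the incomparable orders\<close>

section \<open>Graphs of incomparable divisors\<close>

lemma metric_dimension_eqI:
  assumes "resolving_set \<Gamma> W" "finite W"
    and "\<And>W'. resolving_set \<Gamma> W' \<Longrightarrow> finite W' \<Longrightarrow> card W \<le> card W'"
  shows "metric_dimension \<Gamma> = card W"
  unfolding metric_dimension_def using assms by (intro Least_equality) auto

text \<open>Unlike in common usage, 1 is excluded as well: 1 and \<open>N\<close> are comparable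
  with every divisor, so elements of these orders are isolated.\<close>

definition proper_divisors :: "nat \<Rightarrow> nat set" where
  "proper_divisors N = {d. d dvd N \<and> d \<noteq> 1 \<and> d \<noteq> N}"

text \<open>The totients of all divisors of \<open>N\<close> add up to \<open>N\<close>; the
  divisors 1 and \<open>N\<close>, distinct here, are taken off. Integers avoid truncated
  subtraction.\<close>

lemma
  assumes "N > 1"
  shows card_proper_divisors: "int (card (proper_divisors N)) = int (num_divisors N) - 2"
    and sum_totient_proper_divisors:
      "int (\<Sum>d\<in>proper_divisors N. totient d) = int N - int (totient N) - 1"
proof -
  have fin: "finite {d. d dvd N}" using assms by simp
  have eq: "{d. d dvd N} = insert 1 (insert N (proper_divisors N))"
    unfolding proper_divisors_def by auto
  have notin: "1 \<notin> insert N (proper_divisors N)" "N \<notin> proper_divisors N"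
    using assms by (auto simp: proper_divisors_def)
  have fin': "finite (proper_divisors N)" using fin eq by simp
  have "num_divisors N = card (proper_divisors N) + 2"
    unfolding num_divisors_def eq using notin fin' by simp
  then show "int (card (proper_divisors N)) = int (num_divisors N) - 2" by simp
  have "N = 1 + (totient N + (\<Sum>d\<in>proper_divisors N. totient d))"
    using totient_divisor_sum[of N] notin fin' unfolding eq by simp
  then show "int (\<Sum>d\<in>proper_divisors N. totient d) = int N - int (totient N) - 1" by linarith
qed

text \<open>Models the difference graph of a cyclic group of even order \<open>N\<close> with at
  least two prime divisors, \<open>f\<close> being the element order; \<open>card_fibre\<close> is
  the usual count of elements of a given order.\<close>

locale dvd_incomparability_graph = pair_fin_digraph +
  fixes f :: "'a \<Rightarrow> nat" and N :: nat
  assumes N_pos: "N > 0"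
    and N_even: "even N"
    and other_prime: "\<And>p. \<exists>q. prime q \<and> q dvd N \<and> q \<noteq> p"
    and arc_iff: "\<And>u v. u \<in> pverts G \<Longrightarrow> v \<in> pverts G \<Longrightarrow>
      (u, v) \<in> parcs G \<longleftrightarrow> dvd_incomparable (f u) (f v)"
    and f_range: "\<And>u. u \<in> pverts G \<Longrightarrow> f u \<in> proper_divisors N"
    and card_fibre: "\<And>d. d \<in> proper_divisors N \<Longrightarrow> card {v \<in> pverts G. f v = d} = totient d"
begin

abbreviation "D \<equiv> proper_divisors N"

lemma finite_D: "finite D"
  unfolding proper_divisors_def using N_pos by simp

lemma card_pverts: "card (pverts G) = (\<Sum>d\<in>D. totient d)"
proof -
  have "card (pverts G) = (\<Sum>d\<in>D. card {v \<in> pverts G. f v = d})"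
    using sum.group[OF pair_finite_verts finite_D, of f "\<lambda>_. 1 :: nat"] f_range
    by (simp add: image_subset_iff)
  then show ?thesis using card_fibre by simp
qed

lemma graph_dist_same_order:
  assumes "u \<in> pverts G" "v \<in> pverts G" "f u = f v" "z \<noteq> u" "z \<noteq> v"
  shows "graph_dist G u z = graph_dist G v z"
proof (rule antisym)
  have arcs: "(u, w) \<in> parcs G \<longleftrightarrow> (v, w) \<in> parcs G" for w
    using assms arc_iff in_arcsD2 by metis
  show "graph_dist G u z \<le> graph_dist G v z" "graph_dist G v z \<le> graph_dist G u z"
    using arcs assms by (auto intro: graph_dist_twin_le)
qed

text \<open>Vertices of equal order are twins, so only they themselves can tell each other apart.
  This yields the lower bound on resolving sets.\<close>

lemma resolving_set_inj_on_complement: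
  assumes "resolving_set G W"
  shows "inj_on f (pverts G - W)"
proof (rule inj_onI, rule ccontr)
  fix u v assume uv: "u \<in> pverts G - W" "v \<in> pverts G - W" "f u = f v" "u \<noteq> v"
  then obtain z where "z \<in> W" "graph_dist G u z \<noteq> graph_dist G v z"
    using assms unfolding resolving_set_def by blast
  with uv graph_dist_same_order[of u v z] show False by auto
qed

lemma card_pverts_le_resolving_set:
  assumes "resolving_set G W"
  shows "card (pverts G) \<le> card W + card D"
proof -
  have W: "W \<subseteq> pverts G" using assms unfolding resolving_set_def by blast
  have "card (pverts G - W) \<le> card D"
    using resolving_set_inj_on_complement[OF assms] f_range finite_D
    by (intro card_inj_on_le[of f]) auto
  moreover have "card (pverts G - W) = card (pverts G) - card W"
    using W pair_finite_verts by (intro card_Diff_subset) (auto intro: finite_subset)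
  ultimately show ?thesis by linarith
qed

lemma exists_vertex_of_order:
  assumes "d \<in> D"
  obtains v where "v \<in> pverts G" "f v = d"
proof -
  have "d > 0" using assms N_pos by (auto simp: proper_divisors_def intro: dvd_pos_nat)
  then have "card {v \<in> pverts G. f v = d} > 0" using card_fibre[OF assms] by simp
  then show ?thesis using that by (auto simp: card_gt_0_iff)
qed

text \<open>\<open>totient d\<close> exceeds 1 once \<open>d > 2\<close>; the involution is the only
  vertex alone in its class.\<close>

lemma exists_other_vertex_of_order:
  assumes "d \<in> D" "d \<noteq> 2"
  obtains v where "v \<in> pverts G" "f v = d" "v \<noteq> u"
proof -
  have "d > 2"
    using assms N_pos by (cases "d = 0"; cases "d = 1") (auto simp: proper_divisors_def)
  then have "card {v \<in> pverts G. f v = d} > 1"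
    using card_fibre[OF assms(1)] totient_gt_1 by simp
  then have "\<not> {v \<in> pverts G. f v = d} \<subseteq> {u}"
    using card_mono[of "{u}" "{v \<in> pverts G. f v = d}"] by auto
  then show ?thesis using that by blast
qed

text \<open>A vertex of \<open>W\<close> is told apart by its distance 0 to itself. For two vertices
  outside \<open>W\<close> it suffices that some \<open>z\<close> in \<open>W\<close> is adjacent to
  just one of them.\<close>

lemma resolving_setI:
  assumes W: "W \<subseteq> pverts G" "inj_on f (pverts G - W)"
    and sep: "\<And>d1 d2. d1 \<in> f ` (pverts G - W) \<Longrightarrow> d2 \<in> f ` (pverts G - W) \<Longrightarrow> d1 \<noteq> d2 \<Longrightarrow>
      \<exists>z\<in>W. dvd_incomparable d1 (f z) \<noteq> dvd_incomparable d2 (f z)"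
  shows "resolving_set G W"
  unfolding resolving_set_def
proof (intro conjI ballI impI)
  fix u v assume u: "u \<in> pverts G" and v: "v \<in> pverts G" and uv: "u \<noteq> v"
  show "\<exists>z\<in>W. graph_dist G u z \<noteq> graph_dist G v z"
  proof (cases "u \<in> W \<or> v \<in> W")
    case True
    then show ?thesis using u v uv graph_dist_eq_0_iff by metis
  next
    case False
    then have "f u \<noteq> f v" using W(2) u v uv by (auto dest: inj_onD)
    then obtain z where z: "z \<in> W" "dvd_incomparable (f u) (f z) \<noteq> dvd_incomparable (f v) (f z)"
      using sep[of "f u" "f v"] u v False by blast
    then have "z \<in> pverts G" "z \<noteq> u" "z \<noteq> v" using W(1) False by auto
    then have "(graph_dist G u z = 1) \<noteq> (graph_dist G v z = 1)"
      using z(2) u v arc_iff graph_dist_eq_1_iff by metis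
    then show ?thesis using z(1) by metis
  qed
qed (rule W)

lemma separating_divisor_in_D:
  assumes "d \<in> D" "e dvd N" "dvd_incomparable d e"
  shows "e \<in> D"
  using assms unfolding proper_divisors_def by auto

text \<open>If \<open>d1\<close> and \<open>d2\<close> are incomparable, whichever of them is not 2
  separates them. Nested pairs are left to \<open>unseparated_comparable_divisors\<close>, used in
  both directions.\<close>

lemma exists_separating_divisor:
  assumes d: "d1 \<in> D" "d2 \<in> D" "d1 \<noteq> d2"
  obtains e where "e \<in> D" "e \<noteq> 2" "dvd_incomparable d1 e \<noteq> dvd_incomparable d2 e"
  | k r where "prime r" "r \<noteq> 2" "k > 1" "N = 2 ^ k * r" "{d1, d2} = {r, 2 * r}"
proof (cases "\<exists>e. e dvd N \<and> e \<noteq> 2 \<and> dvd_incomparable d1 e \<noteq> dvd_incomparable d2 e")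
  case True
  then show ?thesis using that(1) d separating_divisor_in_D by metis
next
  case False
  then have eq: "\<And>e. e dvd N \<Longrightarrow> e \<noteq> 2 \<Longrightarrow> dvd_incomparable d1 e \<longleftrightarrow> dvd_incomparable d2 e"
    by blast
  have dN: "d1 dvd N" "d2 dvd N" "d1 \<noteq> 1" "d2 \<noteq> 1" "d1 \<noteq> N" "d2 \<noteq> N"
    using d by (auto simp: proper_divisors_def)
  have "d1 dvd d2 \<or> d2 dvd d1"
    using eq[of d1] eq[of d2] dN d(3) by (metis dvd_refl)
  then show ?thesis
  proof
    assume "d1 dvd d2"
    then obtain k r where "prime r" "r \<noteq> 2" "k > 1" "N = 2 ^ k * r" "d1 = r" "d2 = 2 * r"
      using unseparated_comparable_divisors[OF N_pos other_prime _ _ _ _ _ eq] dN d(3) by metis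
    then show ?thesis using that(2) by blast
  next
    assume "d2 dvd d1"
    then obtain k r where "prime r" "r \<noteq> 2" "k > 1" "N = 2 ^ k * r" "d2 = r" "d1 = 2 * r"
      using unseparated_comparable_divisors[OF N_pos other_prime _ _ _ _ _ eq[symmetric]] dN d(3) by metis
    then show ?thesis using that(2) by blast
  qed
qed

lemma two_in_D: "2 \<in> D"
proof -
  have "N \<noteq> 2" using other_prime[of 2] primes_dvd_imp_eq two_is_prime_nat by blast
  then show ?thesis using N_even by (simp add: proper_divisors_def)
qed

text \<open>\<open>W\<close> omits one chosen vertex \<open>g d\<close> per order; every class
  except that of order 2 has a second vertex, which stays in \<open>W\<close>.\<close>

lemma order_transversal_complement:
  obtains W where "W \<subseteq> pverts G" "card (pverts G) = card W + card D" "inj_on f (pverts G - W)"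
    "f ` (pverts G - W) = D" "D - {2} \<subseteq> f ` W"
proof -
  have "\<forall>d. \<exists>v. d \<in> D \<longrightarrow> v \<in> pverts G \<and> f v = d"
    using exists_vertex_of_order by blast
  then obtain g where g: "\<And>d. d \<in> D \<Longrightarrow> g d \<in> pverts G" "\<And>d. d \<in> D \<Longrightarrow> f (g d) = d"
    by metis
  define R where "R = g ` D"
  have sub: "R \<subseteq> pverts G" using g(1) by (auto simp: R_def)
  have inj: "inj_on f R" using g(2) by (auto simp: R_def inj_on_def)
  have im: "f ` R = D" using g(2) by (force simp: R_def)
  have R: "pverts G - (pverts G - R) = R" using sub by blast
  have "card R = card D" using inj im card_image by metis
  then have "card (pverts G) = card (pverts G - R) + card D"
    using sub pair_finite_verts by (metis card_Diff_subset card_mono finite_subset le_add_diff_inverse2)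
  moreover have "D - {2} \<subseteq> f ` (pverts G - R)"
  proof
    fix d assume "d \<in> D - {2}"
    then have d: "d \<in> D" "d \<noteq> 2" by auto
    obtain z where z: "z \<in> pverts G" "f z = d" "z \<noteq> g d"
      using exists_other_vertex_of_order[OF d] by blast
    have "z \<notin> R" using z(2,3) g(2) unfolding R_def by (metis imageE)
    with z(1,2) show "d \<in> f ` (pverts G - R)" by blast
  qed
  ultimately show ?thesis
    using inj im by (intro that[of "pverts G - R"]) (simp_all only: R Diff_subset)
qed

lemma metric_dimension_generic:
  assumes nonexc: "\<nexists>k r. prime r \<and> r \<noteq> 2 \<and> k > 1 \<and> N = 2 ^ k * r"
  shows "card (pverts G) = metric_dimension G + card D"
proof -
  obtain W where W: "W \<subseteq> pverts G" "card (pverts G) = card W + card D" "inj_on f (pverts G - W)"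
    "f ` (pverts G - W) = D" "D - {2} \<subseteq> f ` W"
    using order_transversal_complement .
  have "resolving_set G W"
  proof (rule resolving_setI)
    fix d1 d2 assume "d1 \<in> f ` (pverts G - W)" "d2 \<in> f ` (pverts G - W)" "d1 \<noteq> d2"
    then have "d1 \<in> D" "d2 \<in> D" "d1 \<noteq> d2" using W(4) by blast+
    then show "\<exists>z\<in>W. dvd_incomparable d1 (f z) \<noteq> dvd_incomparable d2 (f z)"
    proof (cases rule: exists_separating_divisor)
      case (1 e)
      then show ?thesis using W(5) by blast
    qed (use nonexc in blast)
  qed (rule W)+
  moreover have "finite W" using W(1) pair_finite_verts by (rule finite_subset)
  moreover have "card W \<le> card W'" if "resolving_set G W'" for W'
    using card_pverts_le_resolving_set[OF that] W(2) by simp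
  ultimately have "metric_dimension G = card W" by (intro metric_dimension_eqI)
  with W(2) show ?thesis by simp
qed

text \<open>The involution is the only vertex that separates the classes of orders \<open>r\<close> and \<open>2r\<close>,
  but it is also the only vertex of its class.\<close>

lemma card_resolving_set_exceptional:
  assumes r: "prime r" "r \<noteq> 2" and k: "k > 1" and N: "N = 2 ^ k * r"
    and W: "resolving_set G W"
  shows "card (pverts G) < card W + card D"
proof (rule ccontr)
  assume "\<not> card (pverts G) < card W + card D"
  then have le: "card W + card D \<le> card (pverts G)" by simp
  have WV: "W \<subseteq> pverts G" using W unfolding resolving_set_def by blast
  \<comment> \<open>If the strict bound fails, the complement of \<open>W\<close> meets every class,
    so \<open>W\<close> omits in particular the involution and one vertex each of orders
    \<open>r\<close> and \<open>2 * r\<close>.\<close>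
  have "card (f ` (pverts G - W)) = card (pverts G) - card W"
    using resolving_set_inj_on_complement[OF W] WV pair_finite_verts
    by (simp add: card_image card_Diff_subset finite_subset)
  then have "f ` (pverts G - W) = D"
    using le finite_D f_range by (intro card_seteq) auto
  note onto = this
  have rodd: "odd r" using r two_is_prime_nat primes_dvd_imp_eq by metis
  have r1: "r > 1" using r prime_gt_1_nat by blast
  have "4 dvd (2::nat) ^ k" using k le_imp_power_dvd[of 2 k "2::nat"] by simp
  have "2 ^ k > (2::nat) ^ 1" using k by (intro power_strict_increasing) auto
  then have N4: "N > 2 * r" using N r1 by simp
  have cop: "coprime (2 ^ i) r" for i using rodd by simp
  have D: "r \<in> D" "2 * r \<in> D" "2 ^ k \<in> D"
    using r1 k N N4 by (auto simp: proper_divisors_def intro!: mult_dvd_mono)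
  obtain t where t: "t \<in> pverts G - W" "f t = 2" using onto two_in_D by (metis imageE)
  obtain u where u: "u \<in> pverts G - W" "f u = r" using onto D by (metis imageE)
  obtain v where v: "v \<in> pverts G - W" "f v = 2 * r" using onto D by (metis imageE)
  obtain w where w: "w \<in> pverts G" "f w = 2 ^ k" using exists_vertex_of_order D by metis
  have "graph_dist G u z = graph_dist G v z" if z: "z \<in> W" for z
  proof -
    have zV: "z \<in> pverts G" using z WV by blast
    have zuv: "u \<noteq> z" "v \<noteq> z" using z u v by auto
    \<comment> \<open>\<open>totient 2 = 1\<close> makes \<open>t\<close> the only vertex of order
      2, and \<open>t\<close> is not in \<open>W\<close>.\<close>
    have fz2: "f z \<noteq> 2"
    proof
      assume "f z = 2"
      then have "{z, t} \<subseteq> {v \<in> pverts G. f v = 2}" using t zV by auto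
      then have "card {z, t} \<le> 1"
        using card_mono[of "{v \<in> pverts G. f v = 2}"] pair_finite_verts card_fibre[OF two_in_D] by fastforce
      then show False using z t by (cases "z = t") auto
    qed
    have fzD: "f z dvd 2 ^ k * r" "f z \<noteq> 1" "f z \<noteq> 2 ^ k * r"
      using f_range[OF zV] N by (auto simp: proper_divisors_def)
    show ?thesis
    proof (cases "r dvd f z")
      \<comment> \<open>Here \<open>f z = 2 ^ i * r\<close> with \<open>i < k\<close>, comparable
        with both \<open>r\<close> and \<open>2 * r\<close>. The vertex \<open>w\<close> of order
        \<open>2 ^ k\<close> is a common neighbour, so both distances are 2.\<close>
      case True
      then obtain y where y: "f z = y * r" by (metis dvd_div_mult_self)
      then have "y dvd 2 ^ k" using fzD r1 by simp
      then obtain i where i: "y = 2 ^ i" "i \<le> k" by (auto simp: divides_primepow_nat two_is_prime_nat)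
      have ik: "i < k" using i fzD y by (cases "i = k") auto
      have nd: "\<not> 2 ^ k dvd 2 ^ j * r" if "j < k" for j
      proof
        assume "2 ^ k dvd 2 ^ j * r"
        then have "(2 :: nat) ^ k dvd 2 ^ j" using cop[of k] coprime_dvd_mult_left_iff by blast
        then show False using that by (simp add: power_dvd_imp_le nat_dvd_not_less)
      qed
      have nd': "\<not> 2 ^ j * r dvd 2 ^ k" for j
      proof
        assume "2 ^ j * r dvd 2 ^ k"
        then have "r dvd 2 ^ k" by (metis dvd_mult_right)
        then show False using r two_is_prime_nat prime_dvd_power primes_dvd_imp_eq by metis
      qed
      have arcs: "(u, w) \<in> parcs G" "(v, w) \<in> parcs G" "(w, z) \<in> parcs G"
        using u v w zV arc_iff nd[of 0] nd[of 1] nd[OF ik] nd'[of 0] nd'[of 1] nd'[of i] k i y by auto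
      have "f z dvd 2 * r \<or> 2 * r dvd f z" using i y by (cases i) auto
      then have "(u, z) \<notin> parcs G" "(v, z) \<notin> parcs G"
        using arc_iff u v zV True by auto
      then show ?thesis using arcs zuv graph_dist_eq_2 by metis
    next
      \<comment> \<open>Now \<open>f z\<close> is a power of 2 other than 1 and 2, so 4 divides it,
        and both distances are 1.\<close>
      case False
      then have "coprime (f z) r" using r(1) by (metis coprime_commute prime_imp_coprime_nat)
      then have "f z dvd 2 ^ k" using fzD coprime_dvd_mult_left_iff by blast
      then obtain i where i: "f z = 2 ^ i" "i \<le> k" by (auto simp: divides_primepow_nat two_is_prime_nat)
      have i2: "i \<ge> 2" using i fzD fz2 by (cases i; cases "i - 1") auto
      have "4 dvd f z" using i i2 le_imp_power_dvd[of 2 i "2::nat"] by simp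
      then have "\<not> f z dvd 2 * r" "\<not> f z dvd r" using rodd dvd_trans[of 4 "f z" "2 * r"] dvd_trans[of 2 4 r]
        dvd_trans[of 4 "f z" r] by auto
      then have "(u, z) \<in> parcs G" "(v, z) \<in> parcs G"
        using arc_iff u v zV False by (auto dest: dvd_mult_right)
      then show ?thesis using graph_dist_arc zuv by simp
    qed
  qed
  moreover have "u \<noteq> v" using u v r1 by auto
  ultimately show False using W u v unfolding resolving_set_def by blast
qed

text \<open>Adding the involution \<open>t\<close> to \<open>W\<close> repairs the only failure,
  since 2 divides \<open>2 * r\<close> but is incomparable with \<open>r\<close>;
  \<open>card_resolving_set_exceptional\<close> shows that the extra vertex is unavoidable.\<close>

lemma metric_dimension_exceptional:
  assumes r: "prime r" "r \<noteq> 2" and k: "k > 1" and N: "N = 2 ^ k * r"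
  shows "card (pverts G) + 1 = metric_dimension G + card D"
proof -
  obtain W where W: "W \<subseteq> pverts G" "card (pverts G) = card W + card D" "inj_on f (pverts G - W)"
    "f ` (pverts G - W) = D" "D - {2} \<subseteq> f ` W"
    using order_transversal_complement .
  obtain t where t: "t \<in> pverts G - W" "f t = 2"
    using W(4) two_in_D by (metis imageE)
  have fin: "finite W" using W(1) pair_finite_verts by (rule finite_subset)
  then have card: "card (insert t W) = card W + 1" using t by simp
  have sub: "pverts G - insert t W \<subseteq> pverts G - W" by blast
  have sep: "\<exists>z\<in>insert t W. f z = e" if "e \<in> D" for e
    using W(5) that t(2) by blast
  have "resolving_set G (insert t W)"
  proof (rule resolving_setI)
    show "inj_on f (pverts G - insert t W)" using W(3) sub by (rule inj_on_subset)
    fix d1 d2 assume "d1 \<in> f ` (pverts G - insert t W)" "d2 \<in> f ` (pverts G - insert t W)" "d1 \<noteq> d2"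
    then have d: "d1 \<in> D" "d2 \<in> D" "d1 \<noteq> d2" using W(4) sub by blast+
    then show "\<exists>z\<in>insert t W. dvd_incomparable d1 (f z) \<noteq> dvd_incomparable d2 (f z)"
    proof (cases rule: exists_separating_divisor)
      case (1 e)
      then show ?thesis using sep[of e] by blast
    next
      case (2 k' r')
      have "\<not> 2 dvd r'" "\<not> r' dvd 2"
        using 2(1,2) two_is_prime_nat primes_dvd_imp_eq by metis+
      then have "dvd_incomparable d1 2 \<noteq> dvd_incomparable d2 2"
        using 2(5) d(3) by (auto simp: doubleton_eq_iff)
      then show ?thesis using t(2) by (metis insertI1)
    qed
  qed (use W(1) t in blast)
  moreover have "finite (insert t W)" using fin by simp
  moreover have "card (insert t W) \<le> card X" if "resolving_set G X" for X
    using card_resolving_set_exceptional[OF assms that] W(2) card by simp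
  ultimately have "metric_dimension G = card (insert t W)" by (intro metric_dimension_eqI)
  with W(2) card show ?thesis by simp
qed

theorem metric_dimension_eq:
  "int (metric_dimension G) = int N - int (totient N) - int (num_divisors N) +
     (if \<exists>k r. prime r \<and> r \<noteq> 2 \<and> k > 1 \<and> N = 2 ^ k * r then 2 else 1)"
proof -
  have "N > 1" using N_pos N_even by (cases "N = 1") auto
  then have "int (card (pverts G)) = int N - int (totient N) - 1"
    and "int (card D) = int (num_divisors N) - 2"
    using card_pverts sum_totient_proper_divisors card_proper_divisors by auto
  moreover have "card (pverts G) + (if \<exists>k r. prime r \<and> r \<noteq> 2 \<and> k > 1 \<and> N = 2 ^ k * r then 1 else 0)
      = metric_dimension G + card D"
    using metric_dimension_generic metric_dimension_exceptional by auto
  ultimately show ?thesis by (auto split: if_splits)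
qed

end

section \<open>Arcs of the difference graph through orders; counting and splitting in cyclic
  groups\<close>

section \<open>Orders in cyclic subgroups\<close>

context group
begin

lemma common_cyclic_subgroup_iff:
  "(\<exists>C. subgroup C G \<and> cyclic_group (subgroup_generated G C) \<and> x \<in> C \<and> y \<in> C) \<longleftrightarrow>
   (\<exists>c\<in>carrier G. x \<in> generate G {c} \<and> y \<in> generate G {c})" (is "?L \<longleftrightarrow> ?R")
proof
  assume ?L
  then obtain C where C: "subgroup C G" "cyclic_group (subgroup_generated G C)" "x \<in> C" "y \<in> C"
    by blast
  interpret H: group "subgroup_generated G C" by simp
  have carr: "carrier (subgroup_generated G C) = C"
    using C(1) by (rule subgroup.carrier_subgroup_generated_subgroup)
  obtain c where c: "c \<in> C" "C = range (\<lambda>k::int. c [^] k)"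
    using C(2) unfolding H.cyclic_group carr by (auto simp: int_pow_subgroup_generated carr)
  then have "c \<in> carrier G" using C(1) subgroup.mem_carrier by metis
  moreover have "C = generate G {c}"
    using c(2) generate_pow[OF \<open>c \<in> carrier G\<close>] by auto
  ultimately show ?R using C by blast
next
  assume ?R
  then obtain c where c: "c \<in> carrier G" "x \<in> generate G {c}" "y \<in> generate G {c}" by blast
  have sub: "subgroup (generate G {c}) G" using c(1) by (intro generate_is_subgroup) simp
  have cG: "c \<in> generate G {c}" by (auto intro: generate.incl)
  interpret H: group "subgroup_generated G (generate G {c})" by simp
  have carr: "carrier (subgroup_generated G (generate G {c})) = generate G {c}"
    using sub by (rule subgroup.carrier_subgroup_generated_subgroup)
  have "generate G {c} = range (\<lambda>k::int. c [^] k)"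
    using generate_pow[OF c(1)] by auto
  also have "\<dots> = range (\<lambda>k::int. c [^]\<^bsub>subgroup_generated G (generate G {c})\<^esub> k)"
    using cG carr by (simp add: int_pow_subgroup_generated)
  finally have "cyclic_group (subgroup_generated G (generate G {c}))"
    unfolding H.cyclic_group carr using cG by blast
  with sub c show ?L by blast
qed

lemma ord_dvd_ord_if_in_generate:
  assumes "y \<in> carrier G" "x \<in> generate G {y}"
  shows "ord x dvd ord y"
proof -
  obtain k :: int where k: "x = y [^] k" using assms generate_pow by auto
  then have "x [^] ord y = (y [^] ord y) [^] k"
    using assms(1) by (simp add: int_pow_pow mult.commute flip: int_pow_int)
  then have "x [^] ord y = \<one>" using assms(1) by simp
  moreover have "x \<in> carrier G" using k assms(1) by simp
  ultimately show ?thesis using pow_eq_id by blast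
qed

text \<open>A finite cyclic group has one subgroup for each divisor of its order. This turns
  adjacency in the power graph into comparability of orders.\<close>

lemma in_generate_iff_ord_dvd:
  assumes c: "c \<in> carrier G" "ord c > 0" and x: "x \<in> generate G {c}" and y: "y \<in> generate G {c}"
  shows "x \<in> generate G {y} \<longleftrightarrow> ord x dvd ord y"
proof
  have carr: "x \<in> carrier G" "y \<in> carrier G"
    using generate_in_carrier[of "{c}"] c x y by auto
  then show "ord x dvd ord y" if "x \<in> generate G {y}"
    using ord_dvd_ord_if_in_generate that by blast
  assume dvd: "ord x dvd ord y"
  obtain i :: nat where i: "x = c [^] i"
    using x generate_pow_nat c by auto
  obtain j :: nat where j: "y = c [^] j"
    using y generate_pow_nat c by auto
  \<comment> \<open>\<open>y\<close> and \<open>c [^] g\<close> generate the same subgroup, so the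
    aim is to write \<open>x\<close> as a power of \<open>c [^] g\<close>.\<close>
  define g where "g = gcd (ord c) j"
  have "g dvd ord c" unfolding g_def by simp
  then obtain m where m: "ord c = g * m" by (rule dvdE)
  have m0: "m > 0" "g > 0" using m c by (auto intro: Nat.gr0I)
  have "y [^] m = \<one>"
  proof -
    have "ord c dvd j * m" unfolding m by (rule mult_dvd_mono) (simp_all add: g_def)
    then show ?thesis using c(1) j by (simp add: nat_pow_pow pow_eq_id)
  qed
  then have "ord y dvd m" using carr pow_eq_id by blast
  then have "x [^] m = \<one>" using dvd carr pow_eq_id dvd_trans by blast
  then have "ord c dvd i * m" using c i by (simp add: nat_pow_pow pow_eq_id)
  then have "g dvd i" using m m0 by simp
  then obtain q where q: "i = g * q" by (rule dvdE)
  \<comment> \<open>By Bezout, \<open>c [^] g\<close> is itself a power of \<open>y\<close>, because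
    \<open>c [^] ord c\<close> vanishes.\<close>
  obtain u v :: int where uv: "u * int (ord c) + v * int j = int g"
    using bezout_int[of "int (ord c)" "int j"] unfolding g_def by auto
  have "c [^] (int g) = y [^] v"
  proof -
    have "c [^] (int g) = c [^] (int (ord c) * u) \<otimes> c [^] (int j * v)"
      using c(1) by (simp add: int_pow_mult mult.commute flip: uv)
    also have "c [^] (int (ord c) * u) = \<one>" using c(1) by (simp add: int_pow_eq_id)
    also have "c [^] (int j * v) = y [^] v"
      using c(1) j by (simp add: int_pow_int flip: int_pow_pow)
    finally show ?thesis using c(1) carr by simp
  qed
  then have "x = y [^] (v * int q)"
    using i q c(1) carr by (metis int_pow_int int_pow_pow of_nat_mult)
  then show "x \<in> generate G {y}" using generate_pow[OF carr(2)] by blast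
qed

lemma difference_graph_arc_iff:
  assumes "finite (carrier G)"
  shows "(x, y) \<in> parcs (difference_graph G) \<longleftrightarrow>
    (\<exists>c\<in>carrier G. x \<in> generate G {c} \<and> y \<in> generate G {c}) \<and> dvd_incomparable (ord x) (ord y)"
    (is "_ \<longleftrightarrow> ?C \<and> _")
proof -
  have "x \<in> carrier G" "y \<in> carrier G"
    "x \<in> generate G {y} \<longleftrightarrow> ord x dvd ord y" "y \<in> generate G {x} \<longleftrightarrow> ord y dvd ord x" if C: ?C
  proof -
    obtain c where c: "c \<in> carrier G" "x \<in> generate G {c}" "y \<in> generate G {c}" using C by blast
    have pos: "ord c > 0" using ord_ge_1[OF assms c(1)] by simp
    show "x \<in> carrier G" "y \<in> carrier G"
      using generate_in_carrier[of "{c}"] c by simp_all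
    show "x \<in> generate G {y} \<longleftrightarrow> ord x dvd ord y" "y \<in> generate G {x} \<longleftrightarrow> ord y dvd ord x"
      using in_generate_iff_ord_dvd[OF c(1) pos] c(2,3) by blast+
  qed
  moreover have "(x, y) \<in> parcs (difference_graph G) \<longleftrightarrow>
      x \<noteq> y \<and> ?C \<and> \<not> (x \<in> carrier G \<and> y \<in> carrier G \<and> (x \<in> generate G {y} \<or> y \<in> generate G {x}))"
    unfolding difference_graph_def delete_isolated_def enhanced_power_graph_def power_graph_def
    by (simp add: common_cyclic_subgroup_iff) blast
  ultimately show ?thesis using dvd_refl by metis
qed

text \<open>\<open>a [^] k\<close> has order \<open>ord a div gcd k (ord a)\<close>, so the elements
  of order \<open>d\<close> correspond to the exponents from 1 to \<open>ord a\<close> whose gcd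
  with \<open>ord a\<close> is \<open>ord a div d\<close>.\<close>

lemma card_elements_of_order:
  assumes a: "a \<in> carrier G" "ord a > 0" and d: "d dvd ord a"
  shows "card {x \<in> generate G {a}. ord x = d} = totient d"
proof -
  let ?m = "ord a" and ?K = "{k \<in> {0<..ord a}. gcd k (ord a) = ord a div d}"
  have ord_eq: "ord (a [^] k) = d \<longleftrightarrow> gcd k ?m = ?m div d" if "k > 0" for k :: nat
  proof -
    obtain e where e: "?m = d * e" using d by (rule dvdE)
    obtain h where h: "?m = gcd k ?m * h" by (meson dvdE gcd_dvd2)
    have pos: "d > 0" "e > 0" "gcd k ?m > 0" "h > 0"
      using a e h by (auto intro!: Nat.gr0I)
    have "ord (a [^] k) = h"
      using ord_pow_gen[OF a(1)] that h pos by (metis gcd.commute nonzero_mult_div_cancel_left not_gr_zero)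
    moreover have "?m div d = e" using e pos by simp
    moreover have "h = d \<longleftrightarrow> gcd k ?m = e"
      using e h pos by (metis mult.commute mult_cancel2 not_gr_zero)
    ultimately show ?thesis by simp
  qed
  have image: "(\<lambda>k. a [^] k) ` ?K = {x \<in> generate G {a}. ord x = d}"
  proof (intro equalityI subsetI)
    fix x assume "x \<in> (\<lambda>k. a [^] k) ` ?K"
    then show "x \<in> {x \<in> generate G {a}. ord x = d}"
      using ord_eq generate_pow_nat[OF a(1)] a(2) by auto
  next
    fix x assume "x \<in> {x \<in> generate G {a}. ord x = d}"
    then obtain k :: nat where k: "x = a [^] k" "ord x = d"
      using generate_pow_nat[OF a(1)] a(2) by auto
    \<comment> \<open>Exponents run from 1, not 0, so the residue 0 is represented by
      \<open>ord a\<close>.\<close>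
    define l where "l = (if k mod ?m = 0 then ?m else k mod ?m)"
    have l: "l \<in> {0<..?m}" using a(2) by (auto simp: l_def less_imp_le)
    have "l mod ?m = k mod ?m" by (simp add: l_def)
    then have "int ?m dvd int k - int l" by (metis mod_eq_dvd_iff of_nat_mod)
    then have "a [^] l = a [^] k" using int_pow_eq[OF a(1)] by (metis int_pow_int)
    then have "x = a [^] l" using k by simp
    moreover have "l \<in> ?K" using l ord_eq[of l] k(2) \<open>x = a [^] l\<close> by simp
    ultimately show "x \<in> (\<lambda>k. a [^] k) ` ?K" by blast
  qed
  have "inj_on (\<lambda>k. a [^] k) ?K"
    by (rule inj_on_subset[OF ord_inj'[OF a(1)]]) auto
  then have "card {x \<in> generate G {a}. ord x = d} = card ?K"
    unfolding image[symmetric] by (rule card_image)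
  also have "\<dots> = totient (?m div (?m div d))"
    using a(2) d by (intro card_gcd_eq_totient) auto
  also have "?m div (?m div d) = d" using a(2) d by auto
  finally show ?thesis .
qed

text \<open>Chinese remainder theorem: the exponent is sent to its residues modulo \<open>m\<close>
  and \<open>n\<close>. Coprimality gives injectivity, and counting gives surjectivity.\<close>

lemma cyclic_iso_product:
  assumes a: "a \<in> carrier G" and ord: "ord a = m * n" "m > 0" "n > 0" and cop: "coprime m n"
  shows "subgroup_generated G {a} \<cong> integer_mod_group m \<times>\<times> integer_mod_group n"
proof -
  let ?H = "subgroup_generated G {a}" and ?P = "integer_mod_group m \<times>\<times> integer_mod_group n"
  \<comment> \<open>An arbitrary exponent of \<open>x\<close>, determined only modulo
    \<open>ord a\<close>; \<open>cong\<close> shows that its residues modulo divisors of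
    \<open>ord a\<close> do not depend on the choice.\<close>
  define l where "l x = (SOME k :: int. x = a [^] k)" for x
  define h where "h x = (l x mod int m, l x mod int n)" for x
  have carr: "carrier ?H = range (\<lambda>k::int. a [^] k)"
    using a by (rule carrier_subgroup_generated_by_singleton)
  have l: "x = a [^] l x" if "x \<in> carrier ?H" for x
    unfolding l_def by (rule someI_ex) (use that carr in auto)
  have cong: "l (a [^] k) mod int d = k mod int d" if "d dvd ord a" for d and k :: int
  proof -
    have "a [^] k = a [^] l (a [^] k)" using l carr by blast
    then have "int (ord a) dvd l (a [^] k) - k" using int_pow_eq[OF a] by blast
    then have "int d dvd l (a [^] k) - k" using that by (meson dvd_trans of_nat_dvd_iff)
    then show ?thesis by (simp add: mod_eq_dvd_iff)
  qed
  have h: "h (a [^] k) = (k mod int m, k mod int n)" for k :: int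
    using ord by (simp add: h_def cong)
  have hom: "h \<in> hom ?H ?P"
  proof (rule homI)
    show "h x \<in> carrier ?P" for x
      using ord by (simp add: h_def carrier_integer_mod_group)
    show "h (x \<otimes>\<^bsub>?H\<^esub> y) = h x \<otimes>\<^bsub>?P\<^esub> h y" if xy: "x \<in> carrier ?H" "y \<in> carrier ?H" for x y
    proof -
      obtain i j :: int where "x = a [^] i" "y = a [^] j" using xy carr by blast
      then show ?thesis using a by (simp add: h mod_add_eq flip: int_pow_mult)
    qed
  qed
  have "inj_on h (carrier ?H)"
  proof (rule inj_onI)
    fix x y assume xy: "x \<in> carrier ?H" "y \<in> carrier ?H" "h x = h y"
    obtain i j :: int where ij: "x = a [^] i" "y = a [^] j" using xy carr by blast
    have "int m dvd j - i" "int n dvd j - i" using xy(3) by (simp_all add: ij h mod_eq_dvd_iff dvd_diff_commute)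
    then have "int (ord a) dvd j - i" using ord cop by (simp add: divides_mult)
    then show "x = y" using ij int_pow_eq[OF a] by blast
  qed
  moreover have "card (carrier ?H) = card (carrier ?P)"
  proof -
    have "card (carrier ?H) = m * n" using cyclic_order_is_ord[OF a] ord(1) by (simp add: Coset.order_def)
    then show ?thesis using ord by (simp add: carrier_integer_mod_group card_cartesian_product)
  qed
  moreover have "finite (carrier ?P)" using ord by (simp add: carrier_integer_mod_group)
  moreover have "h ` carrier ?H \<subseteq> carrier ?P" using hom unfolding hom_def by blast
  ultimately have "bij_betw h (carrier ?H) (carrier ?P)"
    by (metis bij_betw_def card_image card_subset_eq)
  with hom show ?thesis unfolding is_iso_def iso_def by blast
qed

end


section \<open>Normal form in the generalized quaternion group, and its difference graph\<close>

section \<open>Generalized quaternion groups\<close>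

context generalized_quaternion
begin

lemma finite_carrier: "n > 0 \<Longrightarrow> finite (carrier G)"
  using order_eq order_gt_0_iff_finite by simp

lemma powers_of_a_times_b:
  "a [^] k \<otimes> b = b \<otimes> a [^] (- k)" for k :: int
proof -
  have nat: "a [^] int i \<otimes> b = b \<otimes> a [^] (- int i)" for i :: nat
  proof (induction i)
    case (Suc i)
    have "a [^] int (Suc i) \<otimes> b = a [^] int i \<otimes> (a \<otimes> b)"
      using a_closed b_closed by (simp add: int_pow_int m_assoc del: of_nat_Suc)
    also have "\<dots> = (a [^] int i \<otimes> b) \<otimes> inv a"
      using a_closed b_closed by (simp add: a_b m_assoc)
    also have "\<dots> = b \<otimes> (a [^] (- int i) \<otimes> a [^] (- 1 :: int))"
      using a_closed b_closed by (simp add: Suc.IH m_assoc int_pow_neg)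
    also have "\<dots> = b \<otimes> a [^] (- int (Suc i))"
      using a_closed by (simp add: algebra_simps flip: int_pow_mult)
    finally show ?case .
  qed (use b_closed in simp)
  show ?thesis
  proof (cases k rule: int_cases2)
    case (nonpos i)
    \<comment> \<open>Inserting a cancelling pair of powers on the right exposes
      \<open>b \<otimes> a [^] (- int i)\<close>, to which the case of natural exponents applies
      backwards.\<close>
    have "a [^] (- int i) \<otimes> b = a [^] (- int i) \<otimes> (b \<otimes> a [^] (- int i)) \<otimes> a [^] int i"
      using a_closed b_closed by (simp add: m_assoc flip: int_pow_mult)
    also have "\<dots> = b \<otimes> a [^] int i"
      using a_closed b_closed by (simp add: m_assoc flip: nat int_pow_mult) (simp flip: m_assoc int_pow_mult)
    finally show ?thesis using nonpos by simp
  qed (simp add: nat)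
qed

lemma b_b: "b \<otimes> b = a [^] int n"
  using a_pow_n b_closed by (simp add: int_pow_int numeral_2_eq_2)

lemma coset_mult:
  fixes i j :: int
  shows "a [^] i \<otimes> (b \<otimes> a [^] j) = b \<otimes> a [^] (j - i)"
    and "(b \<otimes> a [^] i) \<otimes> (b \<otimes> a [^] j) = a [^] (int n + j - i)"
proof -
  show *: "a [^] i \<otimes> (b \<otimes> a [^] j) = b \<otimes> a [^] (j - i)" for i j :: int
  proof -
    have "a [^] i \<otimes> (b \<otimes> a [^] j) = (a [^] i \<otimes> b) \<otimes> a [^] j"
      using a_closed b_closed by (simp add: m_assoc)
    also have "\<dots> = b \<otimes> (a [^] (- i) \<otimes> a [^] j)"
      using a_closed b_closed by (simp add: powers_of_a_times_b m_assoc)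
    finally show ?thesis using a_closed by (simp flip: int_pow_mult)
  qed
  have "(b \<otimes> a [^] i) \<otimes> (b \<otimes> a [^] j) = b \<otimes> (b \<otimes> a [^] (j - i))"
    using a_closed b_closed by (simp add: m_assoc *)
  also have "\<dots> = (b \<otimes> b) \<otimes> a [^] (j - i)"
    using a_closed b_closed by (simp add: m_assoc)
  also have "\<dots> = a [^] (int n + (j - i))"
    using a_closed by (simp only: b_b int_pow_mult)
  finally show "(b \<otimes> a [^] i) \<otimes> (b \<otimes> a [^] j) = a [^] (int n + j - i)" by (simp add: add_diff_eq)
qed

text \<open>The powers of \<open>a\<close> and their left translates by \<open>b\<close> contain the
  generators and their inverses and are closed under products by \<open>coset_mult\<close>.\<close>

lemma carrier_cases:
  assumes "x \<in> carrier G"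
  shows "(\<exists>k::int. x = a [^] k) \<or> (\<exists>k::int. x = b \<otimes> a [^] k)"
proof -
  have "x \<in> generate G {a, b}" using assms generated by simp
  then show ?thesis
  proof (induction x rule: generate.induct)
    case one
    have "\<one> = a [^] (0 :: int)" by simp
    then show ?case by blast
  next
    case (incl h)
    then have "h = a [^] (1 :: int) \<or> h = b \<otimes> a [^] (0 :: int)" using a_closed b_closed by auto
    then show ?case by blast
  next
    case (inv h)
    have "b \<otimes> (b \<otimes> a [^] (- int n)) = \<one>"
      using coset_mult(2)[of 0 "- int n"] b_closed by simp
    then have "inv b = b \<otimes> a [^] (- int n)"
      using a_closed b_closed by (metis inv_unique' int_pow_closed m_closed inv_equality inv_inv)
    moreover have "inv a = a [^] (- 1 :: int)" using a_closed by (simp add: int_pow_neg)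
    ultimately show ?case using inv by blast
  next
    case (eng x y)
    then consider i j where "x = a [^] (i::int)" "y = a [^] (j::int)"
      | i j where "x = a [^] (i::int)" "y = b \<otimes> a [^] (j::int)"
      | i j where "x = b \<otimes> a [^] (i::int)" "y = a [^] (j::int)"
      | i j where "x = b \<otimes> a [^] (i::int)" "y = b \<otimes> a [^] (j::int)" by blast
    then show ?case
    proof cases
      case 1
      then have "x \<otimes> y = a [^] (i + j)" using a_closed int_pow_mult by simp
      then show ?thesis by blast
    next
      case 3
      then have "x \<otimes> y = b \<otimes> a [^] (i + j)" using a_closed b_closed by (simp add: m_assoc int_pow_mult)
      then show ?thesis by blast
    qed (use coset_mult in blast)+
  qed
qed

text \<open>The relations only give that \<open>ord a\<close> divides \<open>2 * n\<close>. As two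
  cosets of the powers of \<open>a\<close> cover the group, its order \<open>4 * n\<close> is at
  most \<open>2 * ord a\<close>.\<close>

lemma ord_a:
  assumes "n > 0"
  shows "ord a = 2 * n"
proof -
  have dvd: "ord a dvd 2 * n" using a_pow_2n a_closed pow_eq_id by blast
  then have pos: "ord a > 0" using assms by (auto intro: Nat.gr0I)
  let ?A = "generate G {a}"
  have "card ?A = ord a" using generate_pow_card[OF a_closed] by simp
  moreover have fin: "finite ?A"
    using generate_in_carrier[of "{a}"] a_closed by (intro finite_subset[OF _ finite_carrier[OF assms]]) auto
  ultimately have "card (?A \<union> (\<lambda>x. b \<otimes> x) ` ?A) \<le> ord a + ord a"
    using card_image_le[OF fin, of "\<lambda>x. b \<otimes> x"] by (intro order_trans[OF card_Un_le]) simp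
  moreover have "carrier G \<subseteq> ?A \<union> (\<lambda>x. b \<otimes> x) ` ?A"
    using carrier_cases generate_pow[OF a_closed] by blast
  then have "card (carrier G) \<le> card (?A \<union> (\<lambda>x. b \<otimes> x) ` ?A)"
    using fin by (intro card_mono) auto
  ultimately have "4 * n \<le> 2 * ord a" using order_eq by (simp add: Coset.order_def)
  then show ?thesis using dvd_imp_le[OF dvd] assms by simp
qed

lemma pow_4_eq_one:
  assumes "x \<in> carrier G" "x \<notin> generate G {a}"
  shows "x [^] (4 :: nat) = \<one>"
proof -
  obtain k :: int where k: "x = b \<otimes> a [^] k"
    using carrier_cases[OF assms(1)] assms(2) generate_pow[OF a_closed] by blast
  have "x [^] (2 :: nat) = a [^] n"
    using coset_mult(2)[of k k] assms(1) by (simp add: k numeral_2_eq_2 int_pow_int)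
  then have "x [^] (2 * 2 :: nat) = a [^] (n * 2)"
    using assms(1) a_closed by (metis nat_pow_pow)
  then show ?thesis using a_pow_2n by (simp add: mult.commute)
qed

text \<open>A cyclic subgroup with generator outside the powers of \<open>a\<close> has only
  elements of order dividing 4, and such orders form a chain. Conversely, \<open>a\<close> generates
  a common cyclic subgroup.\<close>

lemma difference_graph_arc_iff_quaternion:
  assumes "n > 0"
  shows "(x, y) \<in> parcs (difference_graph G) \<longleftrightarrow>
    x \<in> generate G {a} \<and> y \<in> generate G {a} \<and> dvd_incomparable (ord x) (ord y)"
proof -
  have "x \<in> generate G {a} \<and> y \<in> generate G {a}"
    if c: "c \<in> carrier G" "x \<in> generate G {c}" "y \<in> generate G {c}" 
      and inc: "dvd_incomparable (ord x) (ord y)" for c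
  proof (cases "c \<in> generate G {a}")
    case True
    then have "generate G {c} \<subseteq> generate G {a}"
      using a_closed by (intro generate_subgroup_incl generate_is_subgroup) auto
    with c show ?thesis by blast
  next
    case False
    then have "ord c dvd 2 ^ 2" using pow_4_eq_one c(1) pow_eq_id by simp
    then have "ord x dvd 2 ^ 2" "ord y dvd 2 ^ 2"
      using ord_dvd_ord_if_in_generate c dvd_trans by blast+
    then obtain i j where "ord x = 2 ^ i" "ord y = 2 ^ j"
      using divides_primepow_nat[OF two_is_prime_nat] by blast
    then show ?thesis using inc le_imp_power_dvd nat_le_linear by metis
  qed
  then show ?thesis
    unfolding difference_graph_arc_iff[OF finite_carrier[OF assms]] using a_closed by blast
qed

lemma pverts_difference_graph:
  assumes "n > 0"
  shows "pverts (difference_graph G) =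
    {x \<in> generate G {a}. \<exists>y\<in>generate G {a}. dvd_incomparable (ord x) (ord y)}"
proof -
  have "pverts (difference_graph G) = {x \<in> carrier G. \<exists>y. (x, y) \<in> parcs (difference_graph G)}"
    by (simp add: difference_graph_def delete_isolated_def)
  then show ?thesis
    unfolding difference_graph_arc_iff_quaternion[OF assms]
    using generate_in_carrier[of "{a}"] a_closed by auto
qed

text \<open>A vertex has a neighbour, so \<open>2 * n\<close> has two prime divisors. Then each
  proper divisor has an incomparable one, realised as an order among the powers of \<open>a\<close>,
  so all powers of \<open>a\<close> of a given proper order are vertices.\<close>

lemma dvd_incomparability_graph_difference_graph:
  assumes n: "n > 0" and ne: "pverts (difference_graph G) \<noteq> {}"
  shows "dvd_incomparability_graph (difference_graph G) ord (2 * n)"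
proof -
  interpret pair_graph "difference_graph G"
    using finite_carrier[OF n] by (rule pair_graph_difference_graph)
  have ord_dvd: "ord x dvd 2 * n" if "x \<in> generate G {a}" for x
    using ord_dvd_ord_if_in_generate[OF a_closed that] ord_a[OF n] by simp
  obtain x y where "x \<in> generate G {a}" "y \<in> generate G {a}" "dvd_incomparable (ord x) (ord y)"
    using ne unfolding pverts_difference_graph[OF n] by blast
  then have other_prime: "\<exists>q. prime q \<and> q dvd 2 * n \<and> q \<noteq> p" for p
    using dvd_incomparable_imp_other_prime[of "2 * n" "ord x" "ord y"] ord_dvd n
    by (metis mult_pos_pos zero_less_numeral)
  show ?thesis
  proof unfold_locales
    show "(u, v) \<in> parcs (difference_graph G) \<longleftrightarrow> dvd_incomparable (ord u) (ord v)"
      if "u \<in> pverts (difference_graph G)" "v \<in> pverts (difference_graph G)" for u v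
      using that difference_graph_arc_iff_quaternion[OF n] pverts_difference_graph[OF n] by auto
    show "ord u \<in> proper_divisors (2 * n)" if u: "u \<in> pverts (difference_graph G)" for u
    proof -
      obtain y where "u \<in> generate G {a}" "y \<in> generate G {a}" "dvd_incomparable (ord u) (ord y)"
        using u unfolding pverts_difference_graph[OF n] by blast
      then show ?thesis using ord_dvd by (auto simp: proper_divisors_def)
    qed
    show "card {v \<in> pverts (difference_graph G). ord v = d} = totient d" if d: "d \<in> proper_divisors (2 * n)" for d
    proof -
      have dN: "d dvd 2 * n" "d \<noteq> 1" "d \<noteq> 2 * n" using d by (auto simp: proper_divisors_def)
      obtain e where e: "e dvd 2 * n" "dvd_incomparable d e"
        using exists_dvd_incomparable[OF _ other_prime dN] n by auto
      have "e > 0" using e(1) n by (auto intro: Nat.gr0I)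
      then have "card {x \<in> generate G {a}. ord x = e} > 0"
        using card_elements_of_order[OF a_closed, of e] e n ord_a[OF n] by simp
      then obtain y where "y \<in> generate G {a}" "ord y = e" by (auto simp: card_gt_0_iff)
      then have "{v \<in> pverts (difference_graph G). ord v = d} = {x \<in> generate G {a}. ord x = d}"
        using e unfolding pverts_difference_graph[OF n] by blast
      then show ?thesis using card_elements_of_order[OF a_closed, of d] dN n ord_a[OF n] by simp
    qed
  qed (use n other_prime in auto)
qed

text \<open>Counting elements gives one direction, the Chinese remainder theorem the other.\<close>

lemma iso_two_power_times_prime_iff:
  assumes "n > 0"
  shows "(\<exists>k p :: nat. prime p \<and> p \<noteq> 2 \<and> k > 1 \<and>
      subgroup_generated G {a} \<cong> integer_mod_group (2 ^ k) \<times>\<times> integer_mod_group p) \<longleftrightarrow>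
    (\<exists>k p. prime p \<and> p \<noteq> 2 \<and> k > 1 \<and> 2 * n = 2 ^ k * p)"
proof -
  have "subgroup_generated G {a} \<cong> integer_mod_group (2 ^ k) \<times>\<times> integer_mod_group p \<longleftrightarrow> 2 * n = 2 ^ k * p"
    if p: "prime p" "p \<noteq> 2" for k p :: nat
  proof
    have p0: "p > 0" using p(1) by (rule prime_gt_0_nat)
    assume "subgroup_generated G {a} \<cong> integer_mod_group (2 ^ k) \<times>\<times> integer_mod_group p"
    then have "card (carrier (subgroup_generated G {a})) =
        card (carrier (integer_mod_group (2 ^ k) \<times>\<times> integer_mod_group p))"
      by (auto simp: is_iso_def iso_def dest: bij_betw_same_card)
    also have "\<dots> = 2 ^ k * p"
      using p0 by (simp add: carrier_integer_mod_group card_cartesian_product nat_power_eq)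
    finally show "2 * n = 2 ^ k * p"
      using cyclic_order_is_ord[OF a_closed] ord_a[OF assms] by (simp add: Coset.order_def)
  next
    assume "2 * n = 2 ^ k * p"
    moreover have "coprime (2 ^ k) p"
      using p two_is_prime_nat primes_coprime by (metis coprime_power_left_iff)
    ultimately show "subgroup_generated G {a} \<cong> integer_mod_group (2 ^ k) \<times>\<times> integer_mod_group p"
      using ord_a[OF assms] a_closed p prime_gt_0_nat by (intro cyclic_iso_product) auto
  qed
  then show ?thesis by metis
qed

end

text \<open>If \<open>2 * n = 2 ^ m\<close>, the graph has no vertices and dimension 0, whereas the
  formula gives \<open>n - m\<close>; for \<open>n \<ge> 2\<close> these agree only at
  \<open>n = 2\<close>. The last hypothesis leaves out the larger powers of 2.\<close>

theorem theorem2p11: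
  fixes G (structure) and n :: nat
  assumes "n \<ge> 2"
    and "generalized_quaternion G n a b"
    and "n = 2 \<or> pverts (difference_graph G) \<noteq> {}"
  shows "((\<exists>k p :: nat. prime p \<and> p \<noteq> 2 \<and> k > 1 \<and>
             subgroup_generated G {a} \<cong> integer_mod_group (2 ^ k) \<times>\<times> integer_mod_group p) \<longrightarrow>
           int (metric_dimension (difference_graph G)) =
             2 * int n - int (totient (2 * n)) - int (num_divisors (2 * n)) + 2) \<and>
         (\<not> (\<exists>k p :: nat. prime p \<and> p \<noteq> 2 \<and> k > 1 \<and>
               subgroup_generated G {a} \<cong> integer_mod_group (2 ^ k) \<times>\<times> integer_mod_group p) \<longrightarrow>
           int (metric_dimension (difference_graph G)) =
             2 * int n - int (totient (2 * n)) - int (num_divisors (2 * n)) + 1)"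
proof -
  interpret generalized_quaternion G n a b by fact
  have n: "n > 0" using assms(1) by simp
  show ?thesis
  proof (cases "pverts (difference_graph G) = {}")
    case False
    then interpret dvd_incomparability_graph "difference_graph G" ord "2 * n"
      using dvd_incomparability_graph_difference_graph[OF n] by blast
    show ?thesis
      unfolding iso_two_power_times_prime_iff[OF n] using metric_dimension_eq by auto
  next
    \<comment> \<open>For \<open>n = 2\<close> the second formula reads 4 - 2 - 3 + 1 = 0, and the
      first case cannot occur because 4 has no odd prime factor.\<close>
    case True
    then have n2: "n = 2" using assms(3) by blast
    have "resolving_set (difference_graph G) {}"
      using True by (simp add: resolving_set_def)
    then have "metric_dimension (difference_graph G) = 0"
      using metric_dimension_eqI[of "difference_graph G" "{}"] by simp
    moreover have "\<not> (\<exists>k p. prime p \<and> p \<noteq> 2 \<and> k > 1 \<and> 2 * n = 2 ^ k * p)"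
    proof clarify
      fix k p :: nat
      assume p: "prime p" "p \<noteq> 2" and "2 * n = 2 ^ k * p"
      then have "p dvd 2 ^ 2" using n2 by (metis dvd_triv_right power2_eq_square)
      then show False using p two_is_prime_nat prime_dvd_power primes_dvd_imp_eq by metis
    qed
    moreover have "num_divisors 4 = 3"
    proof -
      have "d \<in> {1, 2, 4}" if "d dvd 4" for d :: nat
      proof -
        have "d \<le> 4" using that by (rule dvd_imp_le) simp
        then have "d = 0 \<or> d = 1 \<or> d = 2 \<or> d = 3 \<or> d = 4" by linarith
        then show ?thesis using that by auto
      qed
      then have "{d. d dvd (4::nat)} = {1, 2, 4}" by auto
      then show ?thesis by (simp add: num_divisors_def)
    qed
    ultimately show ?thesis
      unfolding iso_two_power_times_prime_iff[OF n] using n2 by simp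
  qed
qed

end
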